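(* Let $p\in\mathbb{C}[z]$ be a polynomial of degree $d\ge 1$, let $\mathcal{I}_p$ and $\mathcal{I}_{p'}$ be evaluation oracles for $p$ and for its derivative $p'$, let $\Delta=D(c,r)$ be a complex disc with $r>0$, and let $\rho>1$. Let $k$ be the result of the call $P^*(\mathcal{I}_p,\mathcal{I}_{p'},\Delta,\rho)$ of the algorithm described in the context. If $\Delta$ has isolation ratio at least $\rho$ for $p$, then $p$ has exactly $k$ roots in $\Delta$ counted with multiplicity.
   Context: $D(c,r)=\{z\in\mathbb{C}:|z-c|\le r\}$; for $\delta>0$, $\delta D(c,r)=D(c,\delta r)$. A disc $\Delta$ has isolation ratio $\rho$ for $p$ if $\rho>1$ and the set of roots of $p$ in $\frac1\rho\Delta$ equals the set of roots of $p$ in $\rho\Delta$; it has isolation ratio at least $\rho$ if it has isolation ratio $\rho'$ for some $\rho'\ge\rho$. Complex intervals: $\square\mathbb{C}$ denotes the set of complex intervals (products of a real interval for the real part and a real interval for the imaginary part); for $\square a\in\square\mathbb{C}$, $w(\square a)$ is the maximum of the widths of its real and imaginary parts. Arithmetic operations on complex intervals are interval arithmetic operations, i.e. the result contains all values of the operation on elements of the operands; a quotient whose denominator interval contains $0$ is regarded as having infinite width. Oracles: an oracle for $a\in\mathbb{C}$ is a function $\mathcal{O}_a:\mathbb{N}\to\square\mathbb{C}$ with $a\in\mathcal{O}_a(L)$ and $w(\mathcal{O}_a(L))\le 2^{-L}$ for all $L$. An evaluation oracle for a polynomial $f$ is a function $\mathcal{I}_f$ that takes an oracle $\mathcal{O}_a$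 of a complex number $a$ and $L\in\mathbb{N}$ and returns $\mathcal{I}_f(\mathcal{O}_a,L)\in\square\mathbb{C}$ with $f(a)\in\mathcal{I}_f(\mathcal{O}_a,L)$ and $w(\mathcal{I}_f(\mathcal{O}_a,L))\le 2^{-L}$. Algorithm $P^*(\mathcal{I}_p,\mathcal{I}_{p'},\Delta,\rho)$ with $\Delta=D(c,r)$: 1. Set $L\leftarrow 53$, $w\leftarrow 1$, $e\leftarrow 1/4$, $\theta\leftarrow 1/\rho$. 2. Set $q\leftarrow\lceil\log_\theta(\frac{e}{d+e})\rceil$, and let $\omega=e^{2\pi\mathbf{i}/q}$ (usual exponential). 3. While $w\ge 1/2$: compute the complex interval $\square s_0^*$ as $\frac{r}{q}\sum_{g=0}^{q-1}\mathcal{O}_{\omega^g}(L)\,\frac{\mathcal{I}_{p'}(\mathcal{O}_{c+r\omega^g},L)}{\mathcal{I}_{p}(\mathcal{O}_{c+r\omega^g},L)}$; set $w\leftarrow w(\square s_0^* )$; set $L\leftarrow 2L$. 4. Set $\square s_0\leftarrow\square s_0^*+[-1/4,1/4]+\mathbf{i}[-1/4,1/4]$ and return the unique integer contained in $\square s_0$. *)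

theory Defs
  imports
    "HOL-Analysis.Analysis"
    "HOL-Computational_Algebra.Computational_Algebra"
    "HOL-Library.While_Combinator"
begin

text \<open>
  The disc \<open>D(c, r)\<close> is \<^term>\<open>cball c r\<close>, and its dilation by \<open>\<delta>\<close> is \<^term>\<open>cball c (\<delta> * r)\<close>.
\<close>

definition has_isolation_ratio :: "complex poly \<Rightarrow> complex \<Rightarrow> real \<Rightarrow> real \<Rightarrow> bool" where
  "has_isolation_ratio p c r \<rho> \<longleftrightarrow> \<rho> > 1 \<and>
     {z \<in> cball c (1 / \<rho> * r). poly p z = 0} = {z \<in> cball c (\<rho> * r). poly p z = 0}"

definition has_isolation_ratio_at_least :: "complex poly \<Rightarrow> complex \<Rightarrow> real \<Rightarrow> real \<Rightarrow> bool" where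
  "has_isolation_ratio_at_least p c r \<rho> \<longleftrightarrow> (\<exists>\<rho>'\<ge>\<rho>. has_isolation_ratio p c r \<rho>')"


text \<open>
  Unbounded intervals are included, since a quotient of complex intervals may have infinite
  width. Neither openness nor closedness of the endpoints is prescribed.
\<close>

typedef real_ivl = "{I :: real set. is_interval I \<and> I \<noteq> {}}"
  morphisms ivl_set Abs_real_ivl
  by (rule exI[of _ UNIV]) simp

type_synonym complex_ivl = "real_ivl \<times> real_ivl"

definition real_ivl_width :: "real_ivl \<Rightarrow> ereal" where
  "real_ivl_width I = (SUP x\<in>ivl_set I. ereal x) - (INF x\<in>ivl_set I. ereal x)"

definition civl_width :: "complex_ivl \<Rightarrow> ereal" where
  "civl_width A = max (real_ivl_width (fst A)) (real_ivl_width (snd A))"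

definition civl_set :: "complex_ivl \<Rightarrow> complex set" where
  "civl_set A = {z. Re z \<in> ivl_set (fst A) \<and> Im z \<in> ivl_set (snd A)}"

definition civl_point :: "complex \<Rightarrow> complex_ivl" where
  "civl_point z = (Abs_real_ivl {Re z}, Abs_real_ivl {Im z})"

text \<open>
  Only the inclusion property is required of the operations: they need not return the smallest
  enclosing interval.
\<close>

definition interval_arithmetic ::
  "(complex_ivl \<Rightarrow> complex_ivl \<Rightarrow> complex_ivl) \<Rightarrow> (complex_ivl \<Rightarrow> complex_ivl \<Rightarrow> complex_ivl) \<Rightarrow>
   (complex_ivl \<Rightarrow> complex_ivl \<Rightarrow> complex_ivl) \<Rightarrow> bool" where
  "interval_arithmetic add mul quot \<longleftrightarrow>
     (\<forall>A B. \<forall>x\<in>civl_set A. \<forall>y\<in>civl_set B. x + y \<in> civl_set (add A B)) \<and>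
     (\<forall>A B. \<forall>x\<in>civl_set A. \<forall>y\<in>civl_set B. x * y \<in> civl_set (mul A B)) \<and>
     (\<forall>A B. \<forall>x\<in>civl_set A. \<forall>y\<in>civl_set B. y \<noteq> 0 \<longrightarrow> x / y \<in> civl_set (quot A B)) \<and>
     (\<forall>A B. 0 \<in> civl_set B \<longrightarrow> civl_width (quot A B) = \<infinity>)"


type_synonym number_oracle = "nat \<Rightarrow> complex_ivl"

definition is_oracle :: "number_oracle \<Rightarrow> complex \<Rightarrow> bool" where
  "is_oracle Oa a \<longleftrightarrow> (\<forall>L. a \<in> civl_set (Oa L) \<and> civl_width (Oa L) \<le> ereal (1 / 2 ^ L))"

definition is_evaluation_oracle ::
  "(number_oracle \<Rightarrow> nat \<Rightarrow> complex_ivl) \<Rightarrow> complex poly \<Rightarrow> bool" where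
  "is_evaluation_oracle I f \<longleftrightarrow>
     (\<forall>a Oa L. is_oracle Oa a \<longrightarrow>
        poly f a \<in> civl_set (I Oa L) \<and> civl_width (I Oa L) \<le> ereal (1 / 2 ^ L))"


definition P_star_q :: "nat \<Rightarrow> real \<Rightarrow> nat" where
  "P_star_q d \<rho> = nat \<lceil>log (1 / \<rho>) ((1 / 4) / (real d + 1 / 4))\<rceil>"

definition root_of_unity :: "nat \<Rightarrow> complex" where
  "root_of_unity q = exp (2 * of_real pi * \<i> / of_nat q)"

text \<open>
  The interval sum is the right fold of \<^term>\<open>add\<close> over \<open>g = 0, \<dots>, q - 1\<close>, starting from the point
  interval \<open>0\<close>. The argument \<^term>\<open>Or\<close> assigns an oracle to every complex number.
\<close>

definition P_star_sum ::
  "(complex_ivl \<Rightarrow> complex_ivl \<Rightarrow> complex_ivl) \<Rightarrow> (complex_ivl \<Rightarrow> complex_ivl \<Rightarrow> complex_ivl) \<Rightarrow>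
   (complex_ivl \<Rightarrow> complex_ivl \<Rightarrow> complex_ivl) \<Rightarrow> (complex \<Rightarrow> number_oracle) \<Rightarrow>
   (number_oracle \<Rightarrow> nat \<Rightarrow> complex_ivl) \<Rightarrow> (number_oracle \<Rightarrow> nat \<Rightarrow> complex_ivl) \<Rightarrow>
   complex \<Rightarrow> real \<Rightarrow> nat \<Rightarrow> nat \<Rightarrow> complex_ivl" where
  "P_star_sum add mul quot Or Ip Ip' c r q L =
     (let \<omega> = root_of_unity q;
          term = (\<lambda>g. mul (Or (\<omega> ^ g) L)
                        (quot (Ip' (Or (c + of_real r * \<omega> ^ g)) L)
                              (Ip (Or (c + of_real r * \<omega> ^ g)) L)))
      in mul (civl_point (of_real (r / real q)))
             (foldr (\<lambda>g S. add (term g) S) [0..<q] (civl_point 0)))"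

text \<open>
  The loop state is \<open>(L, w, S)\<close>, where \<open>S\<close> holds the last computed interval; its initial value is
  irrelevant because the loop body is executed at least once. The result is \<^term>\<open>None\<close> iff the
  loop does not terminate. The widening in the last step is the exact Minkowski sum: a mere
  enclosure of it might contain several integers.
\<close>

definition P_star ::
  "(complex_ivl \<Rightarrow> complex_ivl \<Rightarrow> complex_ivl) \<Rightarrow> (complex_ivl \<Rightarrow> complex_ivl \<Rightarrow> complex_ivl) \<Rightarrow>
   (complex_ivl \<Rightarrow> complex_ivl \<Rightarrow> complex_ivl) \<Rightarrow> (complex \<Rightarrow> number_oracle) \<Rightarrow> nat \<Rightarrow>
   (number_oracle \<Rightarrow> nat \<Rightarrow> complex_ivl) \<Rightarrow> (number_oracle \<Rightarrow> nat \<Rightarrow> complex_ivl) \<Rightarrow>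
   complex \<Rightarrow> real \<Rightarrow> real \<Rightarrow> int option" where
  "P_star add mul quot Or d Ip Ip' c r \<rho> =
     map_option
       (\<lambda>(L, w, S). THE k :: int.
          of_int k \<in> {x + y | x y. x \<in> civl_set S \<and> \<bar>Re y\<bar> \<le> 1 / 4 \<and> \<bar>Im y\<bar> \<le> 1 / 4})
       (while_option
          (\<lambda>(L, w, S). w \<ge> ereal (1 / 2))
          (\<lambda>(L, w, S). let S' = P_star_sum add mul quot Or Ip Ip' c r (P_star_q d \<rho>) L
                       in (2 * L, civl_width S', S'))
          (53, 1, civl_point 0))"

end

theory Submission
  imports Defs
begin

text \<open>
  With \<open>\<beta> = (\<alpha> - c) / r\<close> for a root \<open>\<alpha>\<close>, the exact sum approximated by the algorithm is
  \<open>s = (\<Sum>\<alpha>. 1 / (1 - \<beta> ^ q))\<close>. Isolation makes each summand differ from the indicator of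
  \<open>\<bar>\<beta>\<bar> \<le> 1\<close> by at most \<open>\<theta>^q / (1 - \<theta>^q)\<close>, where \<open>\<theta> = 1 / \<rho>\<close>, and \<open>q\<close> is chosen such that \<open>d\<close>
  such errors add up to at most \<open>1 / 4\<close>. So the root count lies within \<open>1 / 4\<close> of \<open>s\<close>, hence
  in the widened final interval, whose width is less than \<open>1\<close>.
\<close>

section \<open>Sums over the powers of a root of unity\<close>

lemma root_of_unity_power:
  "root_of_unity q ^ m = exp (2 * of_real pi * \<i> * of_nat m / of_nat q)"
  unfolding root_of_unity_def exp_of_nat_mult[symmetric] by (simp add: mult_ac)

lemma root_of_unity_power_order [simp]: "q > 0 \<Longrightarrow> root_of_unity q ^ q = 1"
  by (simp add: root_of_unity_power)

lemma norm_root_of_unity [simp]: "norm (root_of_unity q) = 1"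
  by (simp add: root_of_unity_def)

lemma root_of_unity_power_eq_1_iff:
  assumes "q > 0"
  shows "root_of_unity q ^ m = 1 \<longleftrightarrow> q dvd m"
  using complex_root_unity_eq_1[of q m] assms by (simp add: root_of_unity_power)

text \<open>This is a geometric sum whose ratio \<open>root_of_unity q ^ m\<close> differs from 1
  but has \<open>q\<close>-th power 1.\<close>

lemma sum_root_of_unity_powers:
  assumes "0 < m" "m < q"
  shows "(\<Sum>g<q. (root_of_unity q ^ g) ^ m) = 0"
proof -
  have "q > 0" "\<not> q dvd m"
    using assms by (auto dest: dvd_imp_le)
  then have "root_of_unity q ^ m \<noteq> 1"
    by (simp add: root_of_unity_power_eq_1_iff)
  moreover have "(root_of_unity q ^ m) ^ q = 1"
    using \<open>q > 0\<close> by (metis mult.commute power_mult power_one root_of_unity_power_order)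
  ultimately have "(\<Sum>g<q. (root_of_unity q ^ m) ^ g) = 0"
    by (simp add: sum_gp_strict)
  then show ?thesis
    by (simp add: power_mult[symmetric] mult.commute)
qed

text \<open>Writing 1 as \<open>(\<omega> ^ g) ^ q\<close> makes \<open>1 - \<beta> ^ q\<close> a
  difference of \<open>q\<close>-th powers, divisible by \<open>\<omega> ^ g - \<beta>\<close>. Each
  summand thus becomes a polynomial in \<open>\<omega> ^ g\<close> over a denominator independent of
  \<open>g\<close>, and summing over \<open>g\<close> removes all exponents not divisible by
  \<open>q\<close>.\<close>

lemma sum_root_of_unity_quotients:
  assumes "q > 0" "\<beta> ^ q \<noteq> 1"
  shows "(\<Sum>g<q. root_of_unity q ^ g / (root_of_unity q ^ g - \<beta>)) = of_nat q / (1 - \<beta> ^ q)"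
proof -
  define \<omega> where "\<omega> = root_of_unity q"
  have unit: "(\<omega> ^ g) ^ q = 1" for g
    using assms(1) by (metis \<omega>_def mult.commute power_mult power_one root_of_unity_power_order)
  have expand: "\<omega> ^ g / (\<omega> ^ g - \<beta>) = (\<Sum>j<q. (\<omega> ^ g) ^ Suc j * \<beta> ^ (q - Suc j)) / (1 - \<beta> ^ q)" for g
  proof -
    have "\<omega> ^ g \<noteq> \<beta>"
      using unit assms(2) by metis
    moreover have "1 - \<beta> ^ q = (\<omega> ^ g - \<beta>) * (\<Sum>j<q. \<beta> ^ (q - Suc j) * (\<omega> ^ g) ^ j)"
      using power_diff_sumr2[of "\<omega> ^ g" q \<beta>] unit by simp
    moreover have "(\<Sum>j<q. (\<omega> ^ g) ^ Suc j * \<beta> ^ (q - Suc j)) =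
        \<omega> ^ g * (\<Sum>j<q. \<beta> ^ (q - Suc j) * (\<omega> ^ g) ^ j)"
      by (simp add: sum_distrib_left mult_ac)
    ultimately show ?thesis
      using assms(2) by (auto simp: frac_eq_eq)
  qed
  have "(\<Sum>g<q. \<omega> ^ g / (\<omega> ^ g - \<beta>)) =
      (\<Sum>j<q. (\<Sum>g<q. (\<omega> ^ g) ^ Suc j) * \<beta> ^ (q - Suc j)) / (1 - \<beta> ^ q)"
    unfolding expand sum_divide_distrib[symmetric] sum_distrib_right by (subst sum.swap) (rule refl)
  \<comment> \<open>The exponents \<open>Suc j\<close> run from 1 to \<open>q\<close>, so only the
    last one survives; its cofactor is \<open>\<beta> ^ 0\<close>.\<close>
  also have "(\<Sum>j<q. (\<Sum>g<q. (\<omega> ^ g) ^ Suc j) * \<beta> ^ (q - Suc j)) =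
      (\<Sum>j<q. if j = q - 1 then of_nat q else 0)"
  proof (intro sum.cong refl)
    fix j assume "j \<in> {..<q}"
    show "(\<Sum>g<q. (\<omega> ^ g) ^ Suc j) * \<beta> ^ (q - Suc j) = (if j = q - 1 then of_nat q else 0)"
    proof (cases "j = q - 1")
      case True
      then have "Suc j = q"
        using assms(1) by simp
      then show ?thesis
        using True by (simp only: unit) simp
    next
      case False
      then have "(\<Sum>g<q. (\<omega> ^ g) ^ Suc j) = 0"
        using \<open>j \<in> {..<q}\<close> unfolding \<omega>_def by (intro sum_root_of_unity_powers) auto
      then show ?thesis
        using False by (simp only: mult_zero_left if_False)
    qed
  qed
  also have "\<dots> = of_nat q"
    using assms(1) by simp
  finally show ?thesis
    unfolding \<omega>_def .
qed

section \<open>Logarithmic derivative and sums over root multisets\<close>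

lemma poly_pderiv_prod_linear:
  fixes A :: "'a :: field multiset"
  assumes "z \<notin># A"
  shows "poly (pderiv (\<Prod>x\<in>#A. [:- x, 1:])) z =
    (\<Sum>x\<in>#A. 1 / (z - x)) * poly (\<Prod>x\<in>#A. [:- x, 1:]) z"
  using assms
proof (induction A)
  case (add a A)
  then have "z - a \<noteq> 0"
    by auto
  define Q where "Q = (\<Prod>x\<in>#A. [:- x, 1:])"
  have "poly (pderiv Q) z = (\<Sum>x\<in>#A. 1 / (z - x)) * poly Q z"
    unfolding Q_def using add by simp
  \<comment> \<open>The product rule contributes an extra \<open>poly Q z\<close>, which is
    \<open>1 / (z - a)\<close> times the value of the new product.\<close>
  then have "poly (pderiv ([:- a, 1:] * Q)) z =
      (1 / (z - a) + (\<Sum>x\<in>#A. 1 / (z - x))) * poly ([:- a, 1:] * Q) z"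
    unfolding pderiv_mult poly_add poly_mult using \<open>z - a \<noteq> 0\<close>
    by (simp add: pderiv_pCons distrib_right)
  then show ?case
    unfolding Q_def by simp
qed simp

text \<open>Over the complex numbers \<open>p\<close> is its leading coefficient times the product
  of its linear factors, repeated by multiplicity; the coefficient cancels in the quotient.\<close>

lemma logarithmic_derivative:
  fixes p :: "complex poly"
  assumes "poly p z \<noteq> 0"
  shows "poly (pderiv p) z / poly p z = (\<Sum>x\<in>#proots p. 1 / (z - x))"
proof -
  define P where "P = (\<Prod>x\<in>#proots p. [:- x, 1:])"
  have p: "p = smult (lead_coeff p) P"
    unfolding P_def by (rule complex_poly_decompose_multiset[symmetric])
  have "p \<noteq> 0"
    using assms by auto
  then have "z \<notin># proots p"
    using assms by simp
  then have "poly (pderiv P) z = (\<Sum>x\<in>#proots p. 1 / (z - x)) * poly P z"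
    unfolding P_def by (rule poly_pderiv_prod_linear)
  moreover have "poly p z = lead_coeff p * poly P z"
    by (subst p) simp
  moreover have "poly (pderiv p) z = lead_coeff p * poly (pderiv P) z"
    by (subst p) (simp add: pderiv_smult)
  ultimately show ?thesis
    using assms by simp
qed

lemma norm_sum_mset_diff_le:
  fixes f g :: "'a \<Rightarrow> 'b :: real_normed_vector"
  assumes "\<And>x. x \<in># A \<Longrightarrow> norm (f x - g x) \<le> e"
  shows "norm ((\<Sum>x\<in>#A. f x) - (\<Sum>x\<in>#A. g x)) \<le> real (size A) * e"
  using assms
proof (induction A)
  case (add a A)
  have "(\<Sum>x\<in>#add_mset a A. f x) - (\<Sum>x\<in>#add_mset a A. g x) =
      (f a - g a) + ((\<Sum>x\<in>#A. f x) - (\<Sum>x\<in>#A. g x))"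
    by simp
  also have "norm \<dots> \<le> e + real (size A) * e"
    using add by (intro norm_triangle_mono) auto
  finally show ?case
    by (simp add: algebra_simps)
qed simp

lemma sum_mset_indicator:
  "(\<Sum>x\<in>#A. if P x then 1 else 0) = (of_nat (size (filter_mset P A)) :: 'a :: semiring_1)"
  by (induction A) auto

lemma sum_mset_sum_swap:
  "(\<Sum>i\<in>I. \<Sum>x\<in>#A. f i x) = (\<Sum>x\<in>#A. \<Sum>i\<in>I. f i x)"
  by (induction A) (simp_all add: sum.distrib)

section \<open>Error analysis: one root, the choice of \<open>q\<close>, then the whole sum\<close>

lemma norm_inverse_one_minus_power_small:
  fixes \<beta> :: complex
  assumes "norm \<beta> \<le> \<theta>" "\<theta> < 1" "q > 0"
  shows "norm (1 / (1 - \<beta> ^ q) - 1) \<le> \<theta> ^ q / (1 - \<theta> ^ q)"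
proof -
  have "0 \<le> \<theta>"
    using assms(1) norm_ge_zero order_trans by blast
  have le: "norm (\<beta> ^ q) \<le> \<theta> ^ q"
    using assms(1) by (simp add: norm_power power_mono)
  have lt: "\<theta> ^ q < 1"
    using \<open>0 \<le> \<theta>\<close> assms by (simp add: power_less_one_iff)
  have ge: "norm (1 - \<beta> ^ q) \<ge> 1 - \<theta> ^ q"
    using norm_triangle_ineq2[of 1 "\<beta> ^ q"] le by simp
  then have "1 - \<beta> ^ q \<noteq> 0"
    using lt by auto
  then have "1 / (1 - \<beta> ^ q) - 1 = \<beta> ^ q / (1 - \<beta> ^ q)"
    by (simp add: field_simps)
  then show ?thesis
    using le lt ge \<open>0 \<le> \<theta>\<close> by (simp only: norm_divide) (intro frac_le, auto)
qed

text \<open>Here \<open>\<beta> ^ q\<close> dominates 1: the denominator has norm at least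
  \<open>(1 / \<theta>) ^ q - 1\<close>, whose reciprocal is exactly the bound for small
  \<open>\<beta>\<close>. Roots inside and outside the disc thus share one error bound.\<close>

lemma norm_inverse_one_minus_power_large:
  fixes \<beta> :: complex
  assumes "1 / \<theta> \<le> norm \<beta>" "0 < \<theta>" "\<theta> < 1" "q > 0"
  shows "norm (1 / (1 - \<beta> ^ q)) \<le> \<theta> ^ q / (1 - \<theta> ^ q)"
proof -
  have lt: "\<theta> ^ q < 1"
    using assms by (simp add: power_less_one_iff)
  have "(1 / \<theta>) ^ q \<le> norm (\<beta> ^ q)"
    using assms by (simp only: norm_power) (intro power_mono, auto)
  then have "norm (1 - \<beta> ^ q) \<ge> (1 / \<theta>) ^ q - 1"
    using norm_triangle_ineq3[of 1 "\<beta> ^ q"] by simp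
  then have "norm (1 - \<beta> ^ q) \<ge> (1 - \<theta> ^ q) / \<theta> ^ q"
    using assms(2) by (simp add: field_simps power_divide)
  moreover have "(1 - \<theta> ^ q) / \<theta> ^ q > 0"
    using lt assms(2) by simp
  ultimately have "1 / norm (1 - \<beta> ^ q) \<le> 1 / ((1 - \<theta> ^ q) / \<theta> ^ q)"
    by (intro divide_left_mono mult_pos_pos) (auto intro: less_le_trans)
  then show ?thesis
    by (simp add: norm_divide)
qed

text \<open>Base and argument of the logarithm both lie strictly between 0 and 1, so it is positive
  and its ceiling is at least 1.\<close>

lemma P_star_q_pos:
  assumes "d \<ge> 1" "\<rho> > 1"
  shows "P_star_q d \<rho> > 0"
proof -
  have "log (1 / \<rho>) ((1 / 4) / (real d + 1 / 4)) > 0"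
    using assms by (subst log_def) (intro divide_neg_neg, auto)
  then show ?thesis
    by (simp add: P_star_q_def)
qed

text \<open>With e = 1/4, the number x = e / (d + e) solves d x / (1 - x) = e. The left side
  increases with x on [0, 1), and \<open>q\<close> is chosen so that \<open>(1 / \<rho>) ^ q\<close>
  is at most x.\<close>

lemma P_star_q_error:
  assumes "d \<ge> 1" "\<rho> > 1" and q: "q = P_star_q d \<rho>"
  shows "real d * ((1 / \<rho>) ^ q / (1 - (1 / \<rho>) ^ q)) \<le> 1 / 4"
proof -
  define \<theta> where "\<theta> = 1 / \<rho>"
  have \<theta>: "0 < \<theta>" "\<theta> < 1"
    using assms by (auto simp: \<theta>_def)
  define x where "x = (1 / 4) / (real d + 1 / 4)"
  have "x > 0"
    by (simp add: x_def add_nonneg_pos)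
  have "log \<theta> x \<le> real q"
    unfolding q P_star_q_def \<theta>_def x_def by linarith
  \<comment> \<open>The base is below 1, so the inequality between the exponents is
    reversed.\<close>
  then have "\<theta> powr real q \<le> \<theta> powr log \<theta> x"
    using \<theta> by (intro powr_mono') auto
  then have "\<theta> ^ q \<le> x"
    using \<theta> \<open>x > 0\<close> by (simp add: powr_realpow)
  then have "real d * \<theta> ^ q \<le> 1 / 4 * (1 - \<theta> ^ q)"
    by (simp add: x_def field_simps)
  moreover have "\<theta> ^ q < 1"
    using \<theta> P_star_q_pos[OF assms(1,2)] q by (simp add: power_less_one_iff)
  ultimately show ?thesis
    unfolding \<theta>_def[symmetric] by (simp add: field_simps)
qed

text \<open>The trapezoidal rule with \<open>q\<close> nodes for the contour integral of p'/p over
  the circle, divided by 2 pi i. It is the exact number that the interval computation is meant to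
  enclose.\<close>

definition power_sum_approx :: "complex poly \<Rightarrow> complex \<Rightarrow> real \<Rightarrow> nat \<Rightarrow> complex" where
  "power_sum_approx p c r q = of_real (r / real q) *
     (\<Sum>g<q. root_of_unity q ^ g *
        (poly (pderiv p) (c + of_real r * root_of_unity q ^ g) /
         poly p (c + of_real r * root_of_unity q ^ g)))"

text \<open>Expanding the logarithmic derivative and swapping the two sums leaves, for each root, a
  sum over the nodes. Rescaling by \<open>z g - x = of_real r * (\<omega> ^ g - \<beta>)\<close>
  cancels \<open>r\<close> and reduces it to \<open>sum_root_of_unity_quotients\<close>.\<close>

lemma power_sum_approx_eq:
  assumes "q > 0" "r > 0"
    and nz: "\<And>z. dist c z = r \<Longrightarrow> poly p z \<noteq> 0"
    and unit: "\<And>x. x \<in># proots p \<Longrightarrow> ((x - c) / of_real r) ^ q \<noteq> 1"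
  shows "power_sum_approx p c r q = (\<Sum>x\<in>#proots p. 1 / (1 - ((x - c) / of_real r) ^ q))"
proof -
  define \<omega> where "\<omega> = root_of_unity q"
  define z where "z g = c + of_real r * \<omega> ^ g" for g
  have z: "poly p (z g) \<noteq> 0" for g
    using assms(2) by (intro nz) (simp add: z_def \<omega>_def dist_norm norm_mult norm_power)
  have "power_sum_approx p c r q =
      of_real (r / real q) * (\<Sum>g<q. \<omega> ^ g * (\<Sum>x\<in>#proots p. 1 / (z g - x)))"
    unfolding power_sum_approx_def \<omega>_def[symmetric] z_def[symmetric] logarithmic_derivative[OF z] ..
  also have "\<dots> = (\<Sum>g<q. \<Sum>x\<in>#proots p. of_real (r / real q) * (\<omega> ^ g / (z g - x)))"
    by (simp add: sum_distrib_left sum_mset_distrib_left)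
  also have "\<dots> = (\<Sum>x\<in>#proots p. \<Sum>g<q. of_real (r / real q) * (\<omega> ^ g / (z g - x)))"
    by (rule sum_mset_sum_swap)
  also have "\<dots> = (\<Sum>x\<in>#proots p. 1 / (1 - ((x - c) / of_real r) ^ q))"
  proof (intro arg_cong[where f = sum_mset] image_mset_cong)
    fix x assume "x \<in># proots p"
    define \<beta> where "\<beta> = (x - c) / of_real r"
    have "of_real (r / real q) * (\<omega> ^ g / (z g - x)) = \<omega> ^ g / (\<omega> ^ g - \<beta>) / of_nat q" for g
    proof -
      have "z g - x = of_real r * (\<omega> ^ g - \<beta>)"
        using assms(2) by (simp add: z_def \<beta>_def field_simps)
      then show ?thesis
        using assms(2) by simp
    qed
    then have "(\<Sum>g<q. of_real (r / real q) * (\<omega> ^ g / (z g - x))) =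
        (\<Sum>g<q. \<omega> ^ g / (\<omega> ^ g - \<beta>)) / of_nat q"
      by (simp only: sum_divide_distrib)
    also have "\<dots> = 1 / (1 - \<beta> ^ q)"
      using sum_root_of_unity_quotients[of q \<beta>] unit[OF \<open>x \<in># proots p\<close>] assms(1)
      by (simp add: \<omega>_def \<beta>_def)
    finally show "(\<Sum>g<q. of_real (r / real q) * (\<omega> ^ g / (z g - x))) =
        1 / (1 - ((x - c) / of_real r) ^ q)"
      unfolding \<beta>_def .
  qed
  finally show ?thesis .
qed

text \<open>The annulus kept free of roots by a ratio \<rho>' \<ge> \<rho> contains the one
  belonging to \<rho>. The outer inequality is strict because the discs are closed.\<close>

lemma isolation_ratio_at_leastD:
  assumes iso: "has_isolation_ratio_at_least p c r \<rho>" and "r > 0" "\<rho> > 1" "poly p z = 0"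
  shows "dist c z \<le> r / \<rho> \<or> \<rho> * r < dist c z"
proof -
  from iso obtain \<rho>' where \<rho>': "\<rho>' \<ge> \<rho>"
    and eq: "{z \<in> cball c (1 / \<rho>' * r). poly p z = 0} = {z \<in> cball c (\<rho>' * r). poly p z = 0}"
    unfolding has_isolation_ratio_at_least_def has_isolation_ratio_def by blast
  have "1 / \<rho>' * r \<le> r / \<rho>" "\<rho> * r \<le> \<rho>' * r"
    using \<rho>' assms(2,3) by (auto simp: frac_le)
  moreover have "dist c z \<le> 1 / \<rho>' * r \<or> \<rho>' * r < dist c z"
    using eq assms(4) by (force simp: set_eq_iff)
  ultimately show ?thesis
    by linarith
qed

lemma power_sum_approx_error:
  assumes "degree p \<ge> 1" "r > 0" "\<rho> > 1"
    and iso: "has_isolation_ratio_at_least p c r \<rho>" and q: "q = P_star_q (degree p) \<rho>"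
  shows "norm (power_sum_approx p c r q -
    of_nat (size (filter_mset (\<lambda>z. z \<in> cball c r) (proots p)))) \<le> 1 / 4"
proof -
  define \<theta> where "\<theta> = 1 / \<rho>"
  have \<theta>: "0 < \<theta>" "\<theta> < 1"
    using assms(3) by (auto simp: \<theta>_def)
  have "q > 0"
    using P_star_q_pos assms(1,3) q by simp
  define b where "b x = (x - c) / of_real r" for x
  have norm_b: "norm (b x) = dist c x / r" for x
    using assms(2) by (simp add: b_def norm_divide dist_norm norm_minus_commute)
  \<comment> \<open>This dichotomy selects the error bound for each root. It also keeps
    \<open>norm (b x)\<close> away from 1, which yields both \<open>nz\<close> and
    \<open>unit\<close> below.\<close>
  have root: "norm (b x) \<le> \<theta> \<and> x \<in> cball c r \<or> 1 / \<theta> \<le> norm (b x) \<and> x \<notin> cball c r"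
    if "poly p x = 0" for x
  proof -
    have "r / \<rho> < r" "r < \<rho> * r"
      using assms(2,3) by (auto simp: field_simps)
    then have "dist c x \<le> r / \<rho> \<and> dist c x \<le> r \<or> \<rho> * r \<le> dist c x \<and> \<not> dist c x \<le> r"
      using isolation_ratio_at_leastD[OF iso assms(2,3) that] by linarith
    moreover have "norm (b x) \<le> \<theta> \<longleftrightarrow> dist c x \<le> r / \<rho>" "1 / \<theta> \<le> norm (b x) \<longleftrightarrow> \<rho> * r \<le> dist c x"
      using assms(2,3) by (auto simp: norm_b \<theta>_def field_simps)
    ultimately show ?thesis
      by simp
  qed
  have "p \<noteq> 0"
    using assms(1) by auto
  then have proots: "poly p x = 0" if "x \<in># proots p" for x
    using that by simp
  have nz: "poly p z \<noteq> 0" if "dist c z = r" for z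
    using root[of z] that \<theta> assms(2) by (auto simp: norm_b)
  have unit: "b x ^ q \<noteq> 1" if "x \<in># proots p" for x
  proof
    assume "b x ^ q = 1"
    then have "norm (b x) = 1"
      using \<open>q > 0\<close> power_eq_1_iff by blast
    then show False
      using root[OF proots[OF that]] \<theta> by auto
  qed
  have "power_sum_approx p c r q = (\<Sum>x\<in>#proots p. 1 / (1 - b x ^ q))"
    using power_sum_approx_eq[of q r c p] nz unit \<open>q > 0\<close> assms(2) by (simp add: b_def)
  moreover have "norm (1 / (1 - b x ^ q) - (if x \<in> cball c r then 1 else 0)) \<le> \<theta> ^ q / (1 - \<theta> ^ q)"
    if "x \<in># proots p" for x
    using root[OF proots[OF that]] \<theta> \<open>q > 0\<close>
      norm_inverse_one_minus_power_small[of "b x" \<theta> q]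
      norm_inverse_one_minus_power_large[of \<theta> "b x" q]
    by auto
  then have "norm ((\<Sum>x\<in>#proots p. 1 / (1 - b x ^ q)) -
      (\<Sum>x\<in>#proots p. if x \<in> cball c r then 1 else 0)) \<le>
      real (size (proots p)) * (\<theta> ^ q / (1 - \<theta> ^ q))"
    by (rule norm_sum_mset_diff_le)
  \<comment> \<open>A complex polynomial has as many roots with multiplicity as its degree, so the
    number of error terms is the \<open>d\<close> from which \<open>q\<close> was computed.\<close>
  moreover have "\<dots> \<le> 1 / 4"
    using P_star_q_error[OF assms(1,3) q] by (simp add: \<theta>_def size_proots_complex)
  ultimately show ?thesis
    by (simp only: sum_mset_indicator)
qed

section \<open>Interval enclosure, the loop and the final rounding\<close>

lemma ivl_set_singleton: "ivl_set (Abs_real_ivl {x}) = {x}"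
  by (rule Abs_real_ivl_inverse) (simp add: is_interval_1)

lemma in_civl_point: "z \<in> civl_set (civl_point z)"
  by (simp add: civl_set_def civl_point_def ivl_set_singleton)

lemma real_ivl_width_less:
  assumes "real_ivl_width I < ereal w" "x \<in> ivl_set I" "y \<in> ivl_set I"
  shows "x - y < w"
proof -
  have "ereal x - ereal y \<le> real_ivl_width I"
    unfolding real_ivl_width_def using assms(2,3)
    by (intro ereal_minus_mono SUP_upper INF_lower)
  then have "ereal (x - y) < ereal w"
    using assms(1) by (simp only: ereal_minus order_le_less_trans)
  then show ?thesis
    by simp
qed

text \<open>Inclusion passes through every operation, at any precision \<open>L\<close>. The
  quotient rule needs a nonzero exact denominator, which holds because the nodes lie on the
  root-free circle.\<close>

lemma power_sum_approx_in_P_star_sum: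
  assumes arith: "interval_arithmetic add mul quot"
    and Or: "\<And>a. is_oracle (Or a) a"
    and Ip: "is_evaluation_oracle Ip p" and Ip': "is_evaluation_oracle Ip' (pderiv p)"
    and "r > 0" and nz: "\<And>z. dist c z = r \<Longrightarrow> poly p z \<noteq> 0"
  shows "power_sum_approx p c r q \<in> civl_set (P_star_sum add mul quot Or Ip Ip' c r q L)"
proof -
  define \<omega> where "\<omega> = root_of_unity q"
  define z where "z g = c + of_real r * \<omega> ^ g" for g
  define t where "t g = \<omega> ^ g * (poly (pderiv p) (z g) / poly p (z g))" for g
  define T where "T g = mul (Or (\<omega> ^ g) L) (quot (Ip' (Or (z g)) L) (Ip (Or (z g)) L))" for g
  have add: "x + y \<in> civl_set (add A B)" if "x \<in> civl_set A" "y \<in> civl_set B" for A B x y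
    using arith that unfolding interval_arithmetic_def by blast
  have mul: "x * y \<in> civl_set (mul A B)" if "x \<in> civl_set A" "y \<in> civl_set B" for A B x y
    using arith that unfolding interval_arithmetic_def by blast
  have quot: "x / y \<in> civl_set (quot A B)" if "x \<in> civl_set A" "y \<in> civl_set B" "y \<noteq> 0" for A B x y
    using arith that unfolding interval_arithmetic_def by blast
  have "t g \<in> civl_set (T g)" for g
  proof -
    have "poly p (z g) \<noteq> 0"
      using assms(5) by (intro nz) (simp add: z_def \<omega>_def dist_norm norm_mult norm_power)
    moreover have "\<omega> ^ g \<in> civl_set (Or (\<omega> ^ g) L)"
      using Or by (auto simp: is_oracle_def)
    moreover have "poly p (z g) \<in> civl_set (Ip (Or (z g)) L)"
      "poly (pderiv p) (z g) \<in> civl_set (Ip' (Or (z g)) L)"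
      using Or Ip Ip' by (auto simp: is_evaluation_oracle_def)
    ultimately show ?thesis
      unfolding t_def T_def by (intro mul quot)
  qed
  \<comment> \<open>Generalised from \<open>[0..<q]\<close> to any list, so that induction follows
    the fold.\<close>
  then have "sum_list (map t gs) \<in> civl_set (foldr (\<lambda>g S. add (T g) S) gs (civl_point 0))" for gs
    by (induction gs) (auto intro: add in_civl_point)
  then have "of_real (r / real q) * sum_list (map t [0..<q]) \<in>
      civl_set (mul (civl_point (of_real (r / real q)))
        (foldr (\<lambda>g S. add (T g) S) [0..<q] (civl_point 0)))"
    by (intro mul in_civl_point)
  moreover have "sum_list (map t [0..<q]) = (\<Sum>g<q. t g)"
    by (simp add: interv_sum_list_conv_sum_set_nat atLeast0LessThan)
  ultimately show ?thesis
    unfolding P_star_sum_def Let_def power_sum_approx_def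
    by (simp only: t_def T_def z_def \<omega>_def)
qed

lemma P_star_SomeE:
  assumes "P_star add mul quot Or d Ip Ip' c r \<rho> = Some k"
  obtains L S where "S = P_star_sum add mul quot Or Ip Ip' c r (P_star_q d \<rho>) L"
    and "civl_width S < ereal (1 / 2)"
    and "k = (THE k :: int.
      of_int k \<in> {x + y | x y. x \<in> civl_set S \<and> \<bar>Re y\<bar> \<le> 1 / 4 \<and> \<bar>Im y\<bar> \<le> 1 / 4})"
proof -
  let ?F = "P_star_sum add mul quot Or Ip Ip' c r (P_star_q d \<rho>)"
  let ?b = "\<lambda>(L :: nat, w, S :: complex_ivl). w \<ge> ereal (1 / 2)"
  let ?step = "\<lambda>(L, w :: ereal, S :: complex_ivl). let S' = ?F L in (2 * L, civl_width S', S')"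
  \<comment> \<open>The loop invariant. Its first disjunct covers the initial state, whose interval
    is a placeholder and whose \<open>w\<close> is 1; that disjunct is excluded on exit. The
    existential is needed since \<open>L\<close> has already been doubled when \<open>S\<close> is
    stored.\<close>
  let ?P = "\<lambda>(L :: nat, w, S). w \<ge> ereal (1 / 2) \<or> w = civl_width S \<and> (\<exists>L. S = ?F L)"
  from assms obtain L w S where loop: "while_option ?b ?step (53, 1, civl_point 0) = Some (L, w, S)"
    and k: "k = (THE k :: int.
      of_int k \<in> {x + y | x y. x \<in> civl_set S \<and> \<bar>Re y\<bar> \<le> 1 / 4 \<and> \<bar>Im y\<bar> \<le> 1 / 4})"
    unfolding P_star_def by auto
  have "?P (53, 1, civl_point 0)"
    by (simp add: one_ereal_def)
  then have "?P (L, w, S)"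
    using while_option_rule[where P = ?P, OF _ loop] by (auto simp: Let_def)
  moreover have "\<not> ?b (L, w, S)"
    using while_option_stop[OF loop] .
  ultimately obtain L where "S = ?F L" "civl_width S < ereal (1 / 2)"
    by (auto simp: not_le)
  then show ?thesis
    using k by (rule that)
qed

text \<open>The offset \<open>of_int n - s\<close> fits into the widening box, so \<open>n\<close>
  is a candidate. Any candidate \<open>k\<close> comes from some \<open>x\<close> in the interval,
  and the real parts give a distance from \<open>k\<close> to \<open>n\<close> below 1/4 + 1/2 + 1/4
  = 1, passing through \<open>x\<close> and \<open>s\<close>.\<close>

lemma unique_integer_near_civl:
  fixes n :: int
  assumes width: "civl_width S < ereal (1 / 2)" and "s \<in> civl_set S" "norm (s - of_int n) \<le> 1 / 4"
  shows "(THE k :: int.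
    of_int k \<in> {x + y | x y. x \<in> civl_set S \<and> \<bar>Re y\<bar> \<le> 1 / 4 \<and> \<bar>Im y\<bar> \<le> 1 / 4}) = n"
proof (rule the_equality)
  have "\<bar>Re (of_int n - s)\<bar> \<le> 1 / 4" "\<bar>Im (of_int n - s)\<bar> \<le> 1 / 4"
    using assms(3) abs_Re_le_cmod[of "of_int n - s"] abs_Im_le_cmod[of "of_int n - s"]
    by (auto simp: norm_minus_commute)
  moreover have "of_int n = s + (of_int n - s)"
    by simp
  ultimately show "of_int n \<in>
      {x + y | x y. x \<in> civl_set S \<and> \<bar>Re y\<bar> \<le> 1 / 4 \<and> \<bar>Im y\<bar> \<le> 1 / 4}"
    using assms(2) by blast
next
  fix k :: int
  assume "of_int k \<in> {x + y | x y. x \<in> civl_set S \<and> \<bar>Re y\<bar> \<le> 1 / 4 \<and> \<bar>Im y\<bar> \<le> 1 / 4}"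
  then obtain x y where k: "of_int k = x + y" and x: "x \<in> civl_set S" and y: "\<bar>Re y\<bar> \<le> 1 / 4"
    by blast
  have "real_ivl_width (fst S) < ereal (1 / 2)"
    using width by (simp add: civl_width_def)
  then have "Re x - Re s < 1 / 2" "Re s - Re x < 1 / 2"
    using x assms(2) by (simp_all only: real_ivl_width_less civl_set_def mem_Collect_eq)
  moreover have "\<bar>Re s - of_int n\<bar> \<le> 1 / 4"
    using assms(3) abs_Re_le_cmod[of "s - of_int n"] by simp
  moreover have "of_int k = Re x + Re y"
    using arg_cong[OF k, of Re] by simp
  ultimately have "\<bar>real_of_int k - real_of_int n\<bar> < 1"
    using y by linarith
  then show "k = n"
    by linarith
qed

theorem proposition4:
  fixes p :: "complex poly" and c :: complex and r \<rho> :: real and k :: int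
    and add mul quot :: "complex_ivl \<Rightarrow> complex_ivl \<Rightarrow> complex_ivl"
    and Or :: "complex \<Rightarrow> number_oracle"
    and Ip Ip' :: "number_oracle \<Rightarrow> nat \<Rightarrow> complex_ivl"
  assumes "degree p \<ge> 1"
    and "r > 0"
    and "\<rho> > 1"
    and "interval_arithmetic add mul quot"
    and "\<And>a. is_oracle (Or a) a"
    and "is_evaluation_oracle Ip p"
    and "is_evaluation_oracle Ip' (pderiv p)"
    and "P_star add mul quot Or (degree p) Ip Ip' c r \<rho> = Some k"
    and "has_isolation_ratio_at_least p c r \<rho>"
  shows "int (size (filter_mset (\<lambda>z. z \<in> cball c r) (proots p))) = k"
proof -
  define q where "q = P_star_q (degree p) \<rho>"
  from assms(8) obtain L S where S: "S = P_star_sum add mul quot Or Ip Ip' c r q L"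
    and width: "civl_width S < ereal (1 / 2)"
    and k: "k = (THE k :: int.
      of_int k \<in> {x + y | x y. x \<in> civl_set S \<and> \<bar>Re y\<bar> \<le> 1 / 4 \<and> \<bar>Im y\<bar> \<le> 1 / 4})"
    unfolding q_def by (rule P_star_SomeE)
  \<comment> \<open>The boundary circle lies inside the root-free annulus, so no exact denominator
    at a node vanishes.\<close>
  have nz: "poly p z \<noteq> 0" if "dist c z = r" for z
  proof
    assume "poly p z = 0"
    then have "r \<le> r / \<rho> \<or> \<rho> * r < r"
      using isolation_ratio_at_leastD[OF assms(9,2,3)] that by blast
    then show False
      using assms(2,3) by (auto simp: field_simps)
  qed
  have "power_sum_approx p c r q \<in> civl_set S"
    unfolding S by (rule power_sum_approx_in_P_star_sum[OF assms(4-7,2) nz])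
  moreover have "norm (power_sum_approx p c r q -
      of_int (int (size (filter_mset (\<lambda>z. z \<in> cball c r) (proots p))))) \<le> 1 / 4"
    using power_sum_approx_error[OF assms(1-3,9) q_def] by simp
  ultimately show ?thesis
    unfolding k by (rule unique_integer_near_civl[OF width, symmetric])
qed

end
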